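(* Let $\lambda\in\mathbb{C}$ with $\lambda\neq 1$, let $r,k\in\mathbb{Z}$ and $n\geq 1$. Then \[ T_{n}^{(r,k)}(x|\lambda)=(x-r)T_{n-1}^{(r,k)}(x|\lambda)-\frac{r\lambda }{1-\lambda}T_{n-1}^{(r+1,k)}(x|\lambda) +\sum_{l=0}^{n-1}\left\{(-1)^{n-1-l}\binom{n-1}{l}\sum_{m=0}^{n-1-l}(-1)^{m}\frac{(m+1)!}{(m+2)^{k}}S_{2}(n-1-l,m)\right\}H_{l}^{(r)}(x-1|\lambda). \]
   Context: For $k\in\mathbb{Z}$, $Li_k(x)=\sum_{n\ge1}x^n/n^k$. For $r,k\in\mathbb{Z}$ the polynomials $T_n^{(r,k)}(x|\lambda)$ are defined by $\left(\frac{1-\lambda}{e^t-\lambda}\right)^r\frac{Li_{k}(1-e^{-t})}{1-e^{-t}}e^{xt}=\sum_{n\ge0}T_n^{(r,k)}(x|\lambda)\frac{t^n}{n!}$ (as formal power series in $t$). The Frobenius-Euler polynomials of order $r$ are defined by $\left(\frac{1-\lambda}{e^t-\lambda}\right)^{r}e^{xt}=\sum_{n\ge0}H_n^{(r)}(x|\lambda)\frac{t^n}{n!}$. $S_2(l,m)$ denotes the Stirling numbers of the second kind, $(e^t-1)^m=m!\sum_{l\ge m}S_2(l,m)\frac{t^l}{l!}$. *)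

theory Defs
  imports
    "HOL-Computational_Algebra.Formal_Power_Series"
    "HOL-Combinatorics.Stirling"
begin

definition polylog_fps :: "int \<Rightarrow> complex fps" where
  "polylog_fps k = Abs_fps (\<lambda>n. if n = 0 then 0 else 1 / (of_nat n powi k))"

text \<open>
  For \<open>\<lambda> \<noteq> 1\<close> the denominator has nonzero constant term, so this series is a unit and its
  integer powers are the genuine ones for negative exponents, too.
\<close>
definition frobenius_euler_fps :: "complex \<Rightarrow> complex fps" where
  "frobenius_euler_fps lam = fps_const (1 - lam) / (fps_exp 1 - fps_const lam)"

text \<open>
  Polynomials in \<open>x\<close> are represented by their values at complex \<open>x\<close>. In \<open>T_poly\<close>, numerator
  and denominator of the polylogarithmic factor both have subdegree 1, so the quotient is exact.
\<close>
definition H_poly :: "int \<Rightarrow> nat \<Rightarrow> complex \<Rightarrow> complex \<Rightarrow> complex" where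
  "H_poly r n x lam = fact n * fps_nth (frobenius_euler_fps lam powi r * fps_exp x) n"

definition T_poly :: "int \<Rightarrow> int \<Rightarrow> nat \<Rightarrow> complex \<Rightarrow> complex \<Rightarrow> complex" where
  "T_poly r k n x lam = fact n *
     fps_nth (frobenius_euler_fps lam powi r
              * (fps_compose (polylog_fps k) (1 - fps_exp (-1)) / (1 - fps_exp (-1)))
              * fps_exp x) n"

text \<open>
  \<^const>\<open>Stirling\<close> has the generating function
  \<open>(e^t - 1)^m = m! * (\<Sum>l. S(l,m) * t^l / l!)\<close>.
\<close>
lemma Stirling_egf:
  "(fps_exp 1 - 1 :: complex fps) ^ m =
     fps_const (fact m) * Abs_fps (\<lambda>l. of_nat (Stirling l m) / fact l)"
proof -
  let ?E = "fps_exp 1 - 1 :: complex fps"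
  have "fact l * fps_nth (?E ^ m) l = fact m * of_nat (Stirling l m)" for l m
  proof (induction l arbitrary: m)
    case 0
    show ?case by (cases m) (simp_all add: fps_nth_power_0)
  next
    case (Suc l)
    show ?case
    proof (cases m)
      case (Suc j)
      have "fps_deriv (?E ^ Suc j) = of_nat (Suc j) * (?E ^ Suc j + ?E ^ j)"
        by (subst fps_deriv_power') (simp add: algebra_simps del: of_nat_Suc)
      then have "fps_nth (fps_deriv (?E ^ Suc j)) l =
          of_nat (Suc j) * (fps_nth (?E ^ Suc j) l + fps_nth (?E ^ j) l)"
        by (metis fps_add_nth fps_mult_left_const_nth fps_of_nat)
      then have "fact (Suc l) * fps_nth (?E ^ Suc j) (Suc l) =
          of_nat (Suc j) * (fact l * fps_nth (?E ^ Suc j) l + fact l * fps_nth (?E ^ j) l)"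
        by (simp add: algebra_simps del: power_Suc of_nat_Suc)
      also have "\<dots> = fact (Suc j) * of_nat (Stirling (Suc l) (Suc j))"
        unfolding Suc.IH by (simp add: algebra_simps)
      finally show ?thesis using \<open>m = Suc j\<close> by simp
    qed simp
  qed
  then show ?thesis by (auto simp: fps_eq_iff field_simps)
qed

end

theory Submission
  imports Defs
begin

text \<open>
  Write \<open>F = (1 - \<lambda>) / (e\<^sup>t - \<lambda>)\<close>, \<open>u = 1 - e\<^bsup>-t\<^esup>\<close> and \<open>A(y) = Li\<^sub>k(y) / y\<close>. The recurrence
  is the coefficient comparison of the derivative of \<open>F\<^sup>r A(u) e\<^bsup>xt\<^esup>\<close>. Here
  \<open>F' = - F (1 + \<lambda> / (1 - \<lambda>) F)\<close> yields the terms with \<open>r\<close>, while \<open>A(u)' = A'(u) e\<^bsup>-t\<^esup>\<close>: the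
  factor \<open>e\<^bsup>-t\<^esup>\<close> shifts \<open>x\<close> to \<open>x - 1\<close>, and the powers of \<open>u\<close> in \<open>A'(u)\<close> expand into Stirling
  numbers.
\<close>

text \<open>Power series do not form a field; for negative \<open>r\<close> one factor cancels
  through \<open>inverse F * F = 1\<close>, which the nonzero constant term ensures.\<close>

lemma fps_power_int_add_1:
  fixes F :: "'a::field fps"
  assumes "fps_nth F 0 \<noteq> 0"
  shows "F powi (r + 1) = F powi r * F"
proof (cases "r \<ge> 0")
  case True
  then have "nat (r + 1) = Suc (nat r)" by simp
  then show ?thesis using True by (simp add: power_int_def mult.commute)
next
  case False
  then have eq: "nat (- r) = Suc (nat (- (r + 1)))" by simp
  have "F powi r * F = inverse F ^ nat (- (r + 1)) * (inverse F * F)"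
    using False eq by (simp add: power_int_def mult_ac)
  also have "\<dots> = inverse F ^ nat (- (r + 1))"
    using assms by (simp add: inverse_mult_eq_1)
  \<comment> \<open>At \<open>r = -1\<close> the new exponent is 0, which falls under the
    nonnegative branch of \<open>powi\<close>.\<close>
  also have "\<dots> = F powi (r + 1)"
    using False by (cases "r = -1") (simp_all add: power_int_def)
  finally show ?thesis by simp
qed

text \<open>\<open>D\<close> is the logarithmic derivative of \<open>F\<close>, and
  \<open>inverse F\<close> has \<open>- D\<close>; so both signs of \<open>r\<close> reduce to
  natural powers.\<close>

lemma fps_deriv_power_int:
  fixes F D :: "'a::field fps"
  assumes "fps_nth F 0 \<noteq> 0" and "fps_deriv F = F * D"
  shows "fps_deriv (F powi r) = of_int r * D * F powi r"
proof -
  have pow: "fps_deriv (G ^ n) = of_nat n * E * G ^ n"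
    if "fps_deriv G = G * E" for G E :: "'a fps" and n
    by (induction n) (simp_all add: that algebra_simps)
  have "inverse F * F = 1"
    using assms(1) by (simp add: inverse_mult_eq_1)
  moreover from assms(1) have "fps_deriv (inverse F) = - fps_deriv F * (inverse F)\<^sup>2"
    by (rule fps_inverse_deriv)
  ultimately have "fps_deriv (inverse F) = inverse F * (- D)"
    by (simp add: assms(2) power2_eq_square algebra_simps)
  from pow[OF this] pow[OF assms(2)] show ?thesis
    by (cases "r \<ge> 0") (simp_all add: power_int_def)
qed

lemma frobenius_euler_fps_nth_0:
  "lam \<noteq> 1 \<Longrightarrow> fps_nth (frobenius_euler_fps lam) 0 = 1"
  unfolding frobenius_euler_fps_def by (subst fps_divide_unit) (simp_all add: field_simps)

lemma fps_deriv_frobenius_euler_fps: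
  assumes "lam \<noteq> 1"
  shows "fps_deriv (frobenius_euler_fps lam) = frobenius_euler_fps lam *
    (- (1 + fps_const (lam / (1 - lam)) * frobenius_euler_fps lam))"
proof -
  let ?B = "fps_exp 1 - fps_const lam"
  have B0: "fps_nth ?B 0 \<noteq> 0" using assms by simp
  define I where "I = inverse ?B"
  have IB: "I * ?B = 1" unfolding I_def using B0 by (rule inverse_mult_eq_1)
  have F: "frobenius_euler_fps lam = fps_const (1 - lam) * I"
    unfolding frobenius_euler_fps_def I_def using B0 by (rule fps_divide_unit)
  have "fps_deriv I = - (fps_exp 1 * I\<^sup>2)"
    unfolding I_def by (subst fps_inverse_deriv[OF B0]) simp
  \<comment> \<open>Splitting \<open>fps_exp 1\<close> as \<open>?B + fps_const lam\<close> removes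
    the exponential and leaves a polynomial in \<open>I\<close>.\<close>
  also have "fps_exp 1 * I\<^sup>2 = (I * ?B) * I + fps_const lam * I\<^sup>2"
    by (simp add: algebra_simps power2_eq_square)
  also have "\<dots> = I + fps_const lam * I\<^sup>2"
    by (simp only: IB mult_1_left)
  finally have dI: "fps_deriv I = - (I + fps_const lam * I\<^sup>2)" .
  have c: "fps_const (lam / (1 - lam)) * (fps_const (1 - lam) * I) = fps_const lam * I"
    using assms by (simp flip: mult.assoc)
  show ?thesis
    unfolding F c fps_deriv_mult_const_left dI
    by (simp only: algebra_simps power2_eq_square mult_1_left mult_1_right
        mult_minus_left mult_minus_right minus_add_distrib)
qed

lemma fps_deriv_frobenius_euler_power_int:
  assumes "lam \<noteq> 1"
  shows "fps_deriv (frobenius_euler_fps lam powi r) =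
    - of_int r * (frobenius_euler_fps lam powi r
      + fps_const (lam / (1 - lam)) * frobenius_euler_fps lam powi (r + 1))"
proof -
  have F0: "fps_nth (frobenius_euler_fps lam) 0 \<noteq> 0"
    using frobenius_euler_fps_nth_0[OF assms] by simp
  show ?thesis
    unfolding fps_power_int_add_1[OF F0]
      fps_deriv_power_int[OF F0 fps_deriv_frobenius_euler_fps[OF assms]]
    by (simp add: algebra_simps)
qed

definition polylog_quotient_fps :: "int \<Rightarrow> complex fps" where
  "polylog_quotient_fps k = Abs_fps (\<lambda>n. 1 / (of_nat (n + 1) powi k))"

lemma polylog_fps_eq: "polylog_fps k = fps_X * polylog_quotient_fps k"
  by (rule fps_ext) (auto simp: polylog_fps_def polylog_quotient_fps_def)

text \<open>Composition is multiplicative and turns the factor \<open>fps_X\<close> of the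
  polylogarithm into \<open>u\<close>, which cancels.\<close>

lemma polylog_fps_compose_divide:
  assumes "fps_nth u 0 = 0" and "u \<noteq> 0"
  shows "fps_compose (polylog_fps k) u / u = fps_compose (polylog_quotient_fps k) u"
  using assms by (simp add: polylog_fps_eq fps_compose_mult_distrib)

lemma fps_const_minus_1: "fps_const (-1) = (-1 :: complex fps)"
  by (metis fps_const_1_eq_1 fps_const_neg)

text \<open>The base is \<open>- (fps_exp 1 - 1)\<close> taken at -t: the outer sign gives
  \<open>(-1) ^ m\<close>, the substitution gives \<open>(-1) ^ j\<close>.\<close>

lemma fps_nth_one_minus_exp_power:
  "fps_nth ((1 - fps_exp (-1) :: complex fps) ^ m) j =
     (-1) ^ (j + m) * fact m * of_nat (Stirling j m) / fact j"
proof -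
  have "(1 - fps_exp (-1) :: complex fps) = - fps_compose (fps_exp 1 - 1) (fps_const (-1) * fps_X)"
    by (simp add: fps_compose_sub_distrib fps_exp_compose_linear)
  then have "(1 - fps_exp (-1) :: complex fps) ^ m =
      fps_const ((-1) ^ m) * fps_compose ((fps_exp 1 - 1) ^ m) (fps_const (-1) * fps_X)"
    by (simp add: power_minus[of "fps_compose _ _"] fps_compose_power fps_const_minus_1
        flip: fps_const_power)
  then show ?thesis
    by (simp add: fps_nth_compose_linear Stirling_egf power_add)
qed

text \<open>The derivative has coefficients \<open>(m + 1) / (m + 2) powi k\<close>; the factor
  \<open>m + 1\<close> merges with the \<open>fact m\<close> from the power of u.\<close>

lemma fps_nth_compose_one_minus_exp:
  "fps_nth (fps_compose (fps_deriv (polylog_quotient_fps k)) (1 - fps_exp (-1))) j =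
    (-1) ^ j / fact j * (\<Sum>m = 0..j. (-1) ^ m * (fact (m + 1) / (of_nat (m + 2) powi k))
                 * of_nat (Stirling j m))"
  by (simp add: fps_compose_nth fps_nth_one_minus_exp_power polylog_quotient_fps_def
      sum_distrib_left power_add mult_ac add_ac divide_inverse)

theorem theorem5:
  fixes lam x :: complex and r k :: int and n :: nat
  assumes "lam \<noteq> 1" and "n \<ge> 1"
  shows "T_poly r k n x lam =
    (x - of_int r) * T_poly r k (n - 1) x lam
    - of_int r * lam / (1 - lam) * T_poly (r + 1) k (n - 1) x lam
    + (\<Sum>l = 0..n - 1.
        ((-1) ^ (n - 1 - l) * of_nat ((n - 1) choose l)
          * (\<Sum>m = 0..n - 1 - l.
               (-1) ^ m * (fact (m + 1) / (of_nat (m + 2) powi k))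
                 * of_nat (Stirling (n - 1 - l) m)))
        * H_poly r l (x - 1) lam)"
proof -
  obtain p where n: "n = Suc p" using assms(2) by (cases n) auto
  define u :: "complex fps" where "u = 1 - fps_exp (-1)"
  have u0: "fps_nth u 0 = 0" by (simp add: u_def)
  have "fps_nth u 1 \<noteq> 0" by (simp add: u_def)
  then have u: "u \<noteq> 0" by auto
  define P where "P = fps_compose (polylog_quotient_fps k) u"
  define Q where "Q = fps_compose (fps_deriv (polylog_quotient_fps k)) u"
  define F where "F i = frobenius_euler_fps lam powi i" for i
  define G where "G i = F i * P * fps_exp x" for i
  define K where "K = F r * fps_exp (x - 1)"
  have T: "T_poly i k m x lam = fact m * fps_nth (G i) m" for i m
    unfolding T_poly_def G_def P_def F_def u_def[symmetric] polylog_fps_compose_divide[OF u0 u] ..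
  have H: "H_poly r m (x - 1) lam = fact m * fps_nth K m" for m
    unfolding H_poly_def K_def F_def ..
  have dP: "fps_deriv P = Q * fps_exp (-1)"
    unfolding P_def Q_def by (subst fps_compose_deriv[OF u0]) (simp add: u_def fps_const_minus_1)
  have shift: "fps_exp (-1) * fps_exp x = fps_exp (x - 1)"
    by (simp flip: fps_exp_add_mult)
  define c d :: "complex fps" where "c = fps_const (of_int r)"
    and "d = fps_const (lam / (1 - lam))"
  have dF: "fps_deriv (F r) = - c * (F r + d * F (r + 1))"
    unfolding F_def c_def d_def fps_deriv_frobenius_euler_power_int[OF assms(1)]
    by (simp add: fps_of_int)
  \<comment> \<open>Product rule: the three summands come from \<open>fps_exp x\<close>,
    \<open>F r\<close> and \<open>P\<close>, in this order.\<close>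
  have "fps_deriv (G r) = fps_const x * G r
      - c * (G r + d * G (r + 1))
      + F r * Q * (fps_exp (-1) * fps_exp x)"
    unfolding G_def by (simp add: dP dF algebra_simps)
  also have "F r * Q * (fps_exp (-1) * fps_exp x) = K * Q"
    unfolding shift K_def by (simp only: mult_ac)
  finally have eq: "fps_nth (fps_deriv (G r)) p = x * fps_nth (G r) p
      - of_int r * (fps_nth (G r) p + lam / (1 - lam) * fps_nth (G (r + 1)) p)
      + fps_nth (K * Q) p"
    by (simp add: c_def d_def)
  \<comment> \<open>Differentiation contributes the factor \<open>p + 1 = n\<close>, which turns
    \<open>fact p\<close> into \<open>fact n\<close>.\<close>
  have "fact n * fps_nth (G r) n = fact p * fps_nth (fps_deriv (G r)) p"
    by (simp add: n)
  also have "\<dots> = (x - of_int r) * (fact p * fps_nth (G r) p)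
      - of_int r * lam / (1 - lam) * (fact p * fps_nth (G (r + 1)) p)
      + fact p * fps_nth (K * Q) p"
    unfolding eq by (simp add: algebra_simps)
  finally have "fact n * fps_nth (G r) n = (x - of_int r) * (fact p * fps_nth (G r) p)
      - of_int r * lam / (1 - lam) * (fact p * fps_nth (G (r + 1)) p)
      + fact p * fps_nth (K * Q) p" .
  \<comment> \<open>In the Cauchy product \<open>Q\<close> contributes
    \<open>1 / fact (p - l)\<close>, and \<open>fact p / fact (p - l)\<close> is
    \<open>(p choose l) * fact l\<close>; the \<open>fact l\<close> goes to the Frobenius-Euler
    polynomial.\<close>
  moreover have "fact p * fps_nth (K * Q) p = (\<Sum>l = 0..p.
        ((-1) ^ (p - l) * of_nat (p choose l)
          * (\<Sum>m = 0..p - l.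
               (-1) ^ m * (fact (m + 1) / (of_nat (m + 2) powi k))
                 * of_nat (Stirling (p - l) m)))
        * (fact l * fps_nth K l))"
    unfolding fps_mult_nth sum_distrib_left[of "fact p"] Q_def u_def fps_nth_compose_one_minus_exp
    by (intro sum.cong refl) (simp add: binomial_fact)
  ultimately show ?thesis
    by (simp add: T H n)
qed

end
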